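(* Let $F$ be a finite monoid and let $r\in\mathbb{N}$. Then the monoid $\mathbb{N}^r\times F$ is of admissible Markov type.
   Context: $\mathbb{N}$ is the set (additive monoid) of non-negative integers. Admissible Artinian group structure: a group $A$ together with, for every integer $n\ge 1$, a collection $\mathcal{H}_n$ of subgroups of $A^n$ (called the admissible subgroups of $A^n$) such that: (1) $\{1_A\},A\in\mathcal{H}_1$; (2) for all $m\ge n\ge 1$ and every projection $\pi:A^m\to A^n$ induced by an injection $\{1,\dots,n\}\to\{1,\dots,m\}$, one has $\pi(H_m)\in\mathcal{H}_n$ and $\pi^{-1}(H_n)\in\mathcal{H}_m$ for all $H_m\in\mathcal{H}_m$, $H_n\in\mathcal{H}_n$; (3) $H\cap K\in\mathcal{H}_n$ for all $n\ge1$ and $H,K\in\mathcal{H}_n$; (4) for every $n\ge 1$, every descending sequence of elements of $\mathcal{H}_n$ eventually stabilizes. For a finite set $E$, admissible subgroups of $A^E$ are defined via any bijection $\{1,\dots,|E|\}\to E$. For a monoid $G$, the right shift action of $G$ on $A^G$ is $(g\star x)(h)=x(hg)$. A subshift is a subset $\Sigma\subset A^G$ with $g\star x\in\Sigma$ for all $g\in G,x\in\Sigma$. For $E\subset G$, $\Sigma_E=\{x|_E:x\in\Sigma\}$. A subshift $\Sigma\subset A^G$ is an admissible group subshift if it is closed in the prodiscrete topology (product topology with $A$ discrete) and $\Sigma_E$ is an admissible subgroup of $A^E$ for every finite $E\subset G$. A subshift of $A^G$ is of finite type if it equals $\Sigma(A^G;D,P)=\{x\in A^G:(g\star x)|_D\in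 P\text{ for all }g\in G\}$ for some finite $D\subset G$ and some $P\subset A^D$. A countable monoid $G$ is of admissible Markov type if for every admissible Artinian group structure $A$, every admissible group subshift $\Sigma$ of $A^G$ is of finite type. *)

theory Defs
  imports "HOL-Analysis.Analysis" "HOL-Algebra.Product_Groups"
begin

(* Elements of a power A^E (E a set of indices, finite or not) are the extensional functions in
   E \<rightarrow>\<^sub>E carrier A; for a set of indices E, the group A^E is product_group E (\<lambda>_. A).
   Precomposition x \<circ> \<sigma>, as a map A^E \<rightarrow> A^I for \<sigma> : I \<rightarrow> E, is compose I x \<sigma>. *)

abbreviation group_power :: "'a monoid \<Rightarrow> 'i set \<Rightarrow> ('i \<Rightarrow> 'a) monoid"
  where "group_power A E \<equiv> product_group E (\<lambda>_. A)"

definition admissible_Artinian ::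
    "'a monoid \<Rightarrow> (nat \<Rightarrow> (nat \<Rightarrow> 'a) set set) \<Rightarrow> bool"
  where "admissible_Artinian A H \<longleftrightarrow>
    group A \<and>
    (\<forall>n\<ge>1. \<forall>K\<in>H n. subgroup K (group_power A {1..n})) \<and>
    {\<one>\<^bsub>group_power A {1..1}\<^esub>} \<in> H 1 \<and>
    carrier (group_power A {1..1}) \<in> H 1 \<and>
    (\<forall>m n \<sigma>. 1 \<le> n \<longrightarrow> n \<le> m \<longrightarrow> \<sigma> \<in> {1..n} \<rightarrow> {1..m} \<longrightarrow> inj_on \<sigma> {1..n} \<longrightarrow>
       (\<forall>K\<in>H m. (\<lambda>x. compose {1..n} x \<sigma>) ` K \<in> H n) \<and>
       (\<forall>K\<in>H n. {x \<in> carrier (group_power A {1..m}). compose {1..n} x \<sigma> \<in> K} \<in> H m)) \<and>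
    (\<forall>n\<ge>1. \<forall>K\<in>H n. \<forall>L\<in>H n. K \<inter> L \<in> H n) \<and>
    (\<forall>n\<ge>1. \<forall>K :: nat \<Rightarrow> (nat \<Rightarrow> 'a) set.
       (\<forall>i. K i \<in> H n) \<and> (\<forall>i. K (Suc i) \<subseteq> K i) \<longrightarrow> (\<exists>N. \<forall>i\<ge>N. K i = K N))"

(* By the projection axiom with m = n, membership does not depend on the enumeration f of E.
   The family H is only meaningful from n = 1 on; for E = {} the only subgroup of the trivial
   group A^E is admissible. *)
definition admissible_subgroup ::
    "'a monoid \<Rightarrow> (nat \<Rightarrow> (nat \<Rightarrow> 'a) set set) \<Rightarrow> 'i set \<Rightarrow> ('i \<Rightarrow> 'a) set \<Rightarrow> bool"
  where "admissible_subgroup A H E K \<longleftrightarrow>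
    subgroup K (group_power A E) \<and>
    (E \<noteq> {} \<longrightarrow> (\<exists>f. bij_betw f {1..card E} E \<and>
                   (\<lambda>x. compose {1..card E} x f) ` K \<in> H (card E)))"

definition shift :: "'g monoid \<Rightarrow> 'g \<Rightarrow> ('g \<Rightarrow> 'a) \<Rightarrow> 'g \<Rightarrow> 'a"
  where "shift G g x = (\<lambda>h\<in>carrier G. x (h \<otimes>\<^bsub>G\<^esub> g))"

definition subshift :: "'g monoid \<Rightarrow> 'a set \<Rightarrow> ('g \<Rightarrow> 'a) set \<Rightarrow> bool"
  where "subshift G A \<Sigma> \<longleftrightarrow>
    \<Sigma> \<subseteq> carrier G \<rightarrow>\<^sub>E A \<and> (\<forall>g\<in>carrier G. \<forall>x\<in>\<Sigma>. shift G g x \<in> \<Sigma>)"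

definition prodiscrete_topology :: "'g set \<Rightarrow> 'a set \<Rightarrow> ('g \<Rightarrow> 'a) topology"
  where "prodiscrete_topology G A = product_topology (\<lambda>_. discrete_topology A) G"

definition admissible_group_subshift ::
    "'g monoid \<Rightarrow> 'a monoid \<Rightarrow> (nat \<Rightarrow> (nat \<Rightarrow> 'a) set set) \<Rightarrow> ('g \<Rightarrow> 'a) set \<Rightarrow> bool"
  where "admissible_group_subshift G A H \<Sigma> \<longleftrightarrow>
    subshift G (carrier A) \<Sigma> \<and>
    closedin (prodiscrete_topology (carrier G) (carrier A)) \<Sigma> \<and>
    (\<forall>E. finite E \<longrightarrow> E \<subseteq> carrier G \<longrightarrow>
       admissible_subgroup A H E ((\<lambda>x. restrict x E) ` \<Sigma>))"

definition subshift_by_patterns ::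
    "'g monoid \<Rightarrow> 'a set \<Rightarrow> 'g set \<Rightarrow> ('g \<Rightarrow> 'a) set \<Rightarrow> ('g \<Rightarrow> 'a) set"
  where "subshift_by_patterns G A D P =
    {x \<in> carrier G \<rightarrow>\<^sub>E A. \<forall>g\<in>carrier G. restrict (shift G g x) D \<in> P}"

definition finite_type :: "'g monoid \<Rightarrow> 'a set \<Rightarrow> ('g \<Rightarrow> 'a) set \<Rightarrow> bool"
  where "finite_type G A \<Sigma> \<longleftrightarrow>
    (\<exists>D P. finite D \<and> D \<subseteq> carrier G \<and> P \<subseteq> D \<rightarrow>\<^sub>E A \<and> \<Sigma> = subshift_by_patterns G A D P)"

(* HOL cannot quantify over types inside a formula: the first argument is the type in which the
   alphabets A live, so "for every A" means this predicate for every type 'a. *)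
definition admissible_Markov_type :: "'a itself \<Rightarrow> 'g monoid \<Rightarrow> bool"
  where "admissible_Markov_type (_ :: 'a itself) G \<longleftrightarrow>
    monoid G \<and> countable (carrier G) \<and>
    (\<forall>(A :: 'a monoid) H \<Sigma>. admissible_Artinian A H \<longrightarrow> admissible_group_subshift G A H \<Sigma> \<longrightarrow>
       finite_type G (carrier A) \<Sigma>)"

definition nat_monoid :: "nat monoid"
  where "nat_monoid = \<lparr>carrier = UNIV, monoid.mult = (+), one = 0\<rparr>"

(* product_group only needs the record structure of its factors, so it also forms products
   of monoids. *)
definition nat_power :: "nat \<Rightarrow> (nat \<Rightarrow> nat) monoid"
  where "nat_power r = product_group {1..r} (\<lambda>_. nat_monoid)"

end

theory Submission
  imports Defs
begin

text \<open>
  The argument is dual to the Groebner basis proof of Hilbert's basis theorem. Enumerate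
  \<open>\<nat>\<^sup>r\<close> by an injective rank compatible with translations, and let \<open>L g\<close> be the set of patterns
  on \<open>{g} \<times> F\<close> of those configurations of \<open>\<Sigma>\<close> that are trivial at all positions of smaller rank.
  These are admissible subgroups of \<open>A\<^sup>F\<close>, and \<open>L (m + k) \<subseteq> L m\<close> by shifting. Dickson's lemma and
  the descending chain condition give a finite \<open>S\<close> such that every \<open>g\<close> dominates some \<open>m \<in> S\<close>
  with \<open>L g = L m\<close>. The patterns on the positions of rank at most that of the elements of \<open>S\<close> then
  define \<open>\<Sigma>\<close>: a configuration that agrees with an element of \<open>\<Sigma>\<close> up to some rank and is locally
  allowed can be corrected at the next position \<open>g\<close> by an element of \<open>L m = L g\<close>.
\<close>

section \<open>Dickson's lemma\<close>

text \<open>A real sequence has a monotone subsequence; if it is a decreasing sequence of naturals,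
  it is constant from an index where the minimum is attained, and its tail is then increasing in the
  weak sense.\<close>

lemma nat_incseq_subseq:
  fixes s :: "nat \<Rightarrow> nat"
  shows "\<exists>\<phi>. strict_mono \<phi> \<and> incseq (\<lambda>n. s (\<phi> n))"
proof -
  obtain f where f: "strict_mono f" "monoseq (\<lambda>n. s (f n))"
    using seq_monosub by blast
  show ?thesis
  proof (cases "incseq (\<lambda>n. s (f n))")
    case True
    then show ?thesis using f by blast
  next
    case False
    then have dec: "s (f n) \<le> s (f m)" if "m \<le> n" for m n
      using f(2) that unfolding monoseq_def incseq_def by blast
    obtain N where N: "\<And>n. s (f N) \<le> s (f n)"
      using exists_least_iff[of "\<lambda>k. \<exists>n. k = s (f n)"] by (metis not_less)
    have "s (f (n + N)) = s (f N)" for n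
      using N dec by (simp add: le_antisym)
    then have "incseq (\<lambda>n. s (f (n + N)))"
      by simp
    moreover have "strict_mono (\<lambda>n. f (n + N))"
      using f(1) by (simp add: strict_mono_def)
    ultimately show ?thesis by blast
  qed
qed

text \<open>Coordinates are treated one at a time: refining a subsequence preserves monotonicity in
  the coordinates already handled.\<close>

lemma Dickson_subseq:
  fixes s :: "nat \<Rightarrow> 'i \<Rightarrow> nat"
  assumes "finite I"
  shows "\<exists>\<phi>. strict_mono \<phi> \<and> (\<forall>i\<in>I. incseq (\<lambda>n. s (\<phi> n) i))"
  using assms
proof (induction I rule: finite_induct)
  case empty
  show ?case using strict_mono_id by blast
next
  case (insert i I)
  then obtain \<phi> where \<phi>: "strict_mono \<phi>" "\<forall>i\<in>I. incseq (\<lambda>n. s (\<phi> n) i)"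
    by blast
  obtain \<psi> where \<psi>: "strict_mono \<psi>" "incseq (\<lambda>n. s (\<phi> (\<psi> n)) i)"
    using nat_incseq_subseq[of "\<lambda>n. s (\<phi> n) i"] by blast
  have "strict_mono (\<lambda>n. \<phi> (\<psi> n))"
    using \<phi>(1) \<psi>(1) by (simp add: strict_mono_def)
  moreover have "incseq (\<lambda>n. s (\<phi> (\<psi> n)) j)" if "j \<in> I" for j
    using \<phi>(2) \<psi>(1) that by (simp add: incseq_def strict_mono_less_eq)
  ultimately show ?case using \<psi>(2) by blast
qed

section \<open>Ranked monoids\<close>

text \<open>The rank plays the role of a monomial order, compatible with the right translations that
  occur in \<open>shift\<close>. \<open>divisor_chain\<close> is the form in which Dickson's lemma
  is used: divisibility, with the quotient on the right, is a well-quasi-order.\<close>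

locale ranked_wqo_monoid = monoid M for M :: "'m monoid" (structure) +
  fixes \<rho> :: "'m \<Rightarrow> nat"
  assumes inj_rank: "inj_on \<rho> (carrier M)"
    and rank_mult: "\<lbrakk>h \<in> carrier M; g \<in> carrier M; k \<in> carrier M; \<rho> h < \<rho> g\<rbrakk>
      \<Longrightarrow> \<rho> (h \<otimes> k) < \<rho> (g \<otimes> k)"
    and divisor_chain: "range (s :: nat \<Rightarrow> 'm) \<subseteq> carrier M
      \<Longrightarrow> \<exists>\<phi>. strict_mono \<phi> \<and> (\<forall>i. \<exists>k\<in>carrier M. s (\<phi> (Suc i)) = s (\<phi> i) \<otimes> k)"
begin

lemma finite_rank_le: "finite {h \<in> carrier M. \<rho> h \<le> N}"
proof (rule finite_imageD)
  show "finite (\<rho> ` {h \<in> carrier M. \<rho> h \<le> N})"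
    by (rule finite_subset[of _ "{..N}"]) auto
  show "inj_on \<rho> {h \<in> carrier M. \<rho> h \<le> N}"
    using inj_rank by (rule inj_on_subset) auto
qed

lemma countable_carrier: "countable (carrier M)"
  using inj_rank by (rule countableI)

text \<open>Plays the part of the finite generation of monomial ideals. \<open>S\<close> collects
  the elements of minimal rank among their left divisors with the same value of \<open>L\<close>.
  Along a divisor chain in \<open>S\<close> the values of \<open>L\<close> descend, so two
  consecutive ones agree, which contradicts the minimality of the later element.\<close>

lemma finite_basis:
  fixes L :: "'m \<Rightarrow> 'b set"
  assumes anti: "\<And>m k. \<lbrakk>m \<in> carrier M; k \<in> carrier M\<rbrakk> \<Longrightarrow> L (m \<otimes> k) \<subseteq> L m"
    and dcc: "\<And>s :: nat \<Rightarrow> 'm. \<lbrakk>range s \<subseteq> carrier M; \<And>i. L (s (Suc i)) \<subseteq> L (s i)\<rbrakk>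
      \<Longrightarrow> \<exists>i. L (s (Suc i)) = L (s i)"
  shows "\<exists>S. finite S \<and> S \<subseteq> carrier M \<and>
    (\<forall>g\<in>carrier M. \<exists>m\<in>S. \<exists>k\<in>carrier M. g = m \<otimes> k \<and> L m = L g)"
proof -
  define S where "S = {g \<in> carrier M. \<forall>m\<in>carrier M. \<forall>k\<in>carrier M.
    g = m \<otimes> k \<and> L m = L g \<longrightarrow> \<rho> g \<le> \<rho> m}"
  have sub: "S \<subseteq> carrier M"
    by (auto simp: S_def)
  moreover have "finite S"
  proof (rule ccontr)
    assume "infinite S"
    then have inf: "infinite (\<rho> ` S)"
      using finite_imageD inj_on_subset[OF inj_rank sub] by blast
    \<comment> \<open>The sequence lists \<open>S\<close> by strictly increasing rank, so a later
      term never has rank at most that of an earlier one.\<close>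
    define s where "s n = inv_into S \<rho> (enumerate (\<rho> ` S) n)" for n
    have sS: "s n \<in> S" and \<rho>s: "\<rho> (s n) = enumerate (\<rho> ` S) n" for n
      unfolding s_def using enumerate_in_set[OF inf, of n]
      by (auto intro: inv_into_into f_inv_into_f)
    have "range s \<subseteq> carrier M"
      using sS sub by blast
    from divisor_chain[OF this] obtain \<phi> where \<phi>: "strict_mono \<phi>"
      and div: "\<And>i. \<exists>k\<in>carrier M. s (\<phi> (Suc i)) = s (\<phi> i) \<otimes> k"
      by blast
    have "L (s (\<phi> (Suc i))) \<subseteq> L (s (\<phi> i))" for i
      using div[of i] anti sS sub by (metis subsetD)
    with dcc[of "\<lambda>i. s (\<phi> i)"] obtain i where eq: "L (s (\<phi> (Suc i))) = L (s (\<phi> i))"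
      using sS sub by blast
    obtain k where "k \<in> carrier M" "s (\<phi> (Suc i)) = s (\<phi> i) \<otimes> k"
      using div by blast
    then have "\<rho> (s (\<phi> (Suc i))) \<le> \<rho> (s (\<phi> i))"
      using eq sS[of "\<phi> (Suc i)"] sS[of "\<phi> i"] unfolding S_def by auto
    then show False
      using \<phi> inf by (simp add: \<rho>s strict_mono_less_eq)
  qed
  moreover have "\<exists>m\<in>S. \<exists>k\<in>carrier M. g = m \<otimes> k \<and> L m = L g" if g: "g \<in> carrier M" for g
  proof -
    \<comment> \<open>The required \<open>m\<close> is a left divisor of \<open>g\<close> of least
      rank with \<open>L m = L g\<close>. It lies in \<open>S\<close> because, by associativity, a
      left divisor of \<open>m\<close> also divides \<open>g\<close>.\<close>
    define Q where "Q m \<longleftrightarrow> m \<in> carrier M \<and> (\<exists>k\<in>carrier M. g = m \<otimes> k) \<and> L m = L g" for m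
    have "Q g"
      using g by (auto simp: Q_def intro!: bexI[of _ \<one>])
    then obtain m where m: "Q m" and min: "\<And>m'. Q m' \<Longrightarrow> \<rho> m \<le> \<rho> m'"
      using ex_has_least_nat[of Q g \<rho>] by blast
    have "m \<in> S"
      unfolding S_def
    proof (intro CollectI conjI ballI impI)
      show "m \<in> carrier M" using m by (simp add: Q_def)
      fix m' k assume "m' \<in> carrier M" "k \<in> carrier M" "m = m' \<otimes> k \<and> L m' = L m"
      then have "Q m'"
        using m by (auto simp: Q_def m_assoc intro!: bexI[of _ "k \<otimes> _"])
      then show "\<rho> m \<le> \<rho> m'" by (rule min)
    qed
    then show ?thesis
      using m by (auto simp: Q_def)
  qed
  ultimately show ?thesis by blast
qed

end

section \<open>Powers of the natural numbers as ranked monoids\<close>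

lemma monoid_product_group:
  assumes "\<And>i. i \<in> I \<Longrightarrow> monoid (G i)"
  shows "monoid (product_group I G)"
proof -
  note [simp] = monoid.m_closed[OF assms] monoid.one_closed[OF assms]
    monoid.m_assoc[OF assms] monoid.l_one[OF assms] monoid.r_one[OF assms]
  show ?thesis
    by (rule monoidI) (auto simp: PiE_iff fun_eq_iff extensional_def)
qed

lemma carrier_nat_power [simp]: "carrier (nat_power r) = {1..r} \<rightarrow>\<^sub>E UNIV"
  and mult_nat_power [simp]: "x \<otimes>\<^bsub>nat_power r\<^esub> y = (\<lambda>i\<in>{1..r}. x i + y i)"
  by (simp_all add: nat_power_def nat_monoid_def)

lemma monoid_nat_power: "monoid (nat_power r)"
  unfolding nat_power_def
  by (rule monoid_product_group) (auto intro!: monoidI simp: nat_monoid_def)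

text \<open>By unique factorisation \<open>x \<mapsto> \<Prod>\<^sub>i p\<^sub>i ^ x\<^sub>i\<close> embeds \<open>\<nat>\<^sup>r\<close> into the multiplicative monoid of
  positive integers, whose order is compatible with multiplication.\<close>

definition prime_code :: "nat \<Rightarrow> (nat \<Rightarrow> nat) \<Rightarrow> nat"
  where "prime_code r x = (\<Prod>i=1..r. enumerate {p. prime p} i ^ x i)"

lemma prime_enumerate: "prime (enumerate {p::nat. prime p} i)"
  using enumerate_in_set[OF primes_infinite, of i] by simp

text \<open>Reading off the exponents makes \<open>prime_code\<close> injective.\<close>

lemma multiplicity_prime_code:
  assumes "j \<in> {1..r}"
  shows "multiplicity (enumerate {p. prime p} j) (prime_code r x) = x j"
proof -
  let ?p = "enumerate {p::nat. prime p}"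
  have inj: "inj ?p"
    by (rule inj_enumerate[OF primes_infinite])
  \<comment> \<open>The product is indexed by the primes themselves, as
    \<open>multiplicity_prod_prime_powers\<close> expects.\<close>
  have "prime_code r x = (\<Prod>q\<in>?p ` {1..r}. q ^ x (inv_into UNIV ?p q))"
    unfolding prime_code_def
    by (subst prod.reindex) (simp_all add: inj inj_on_subset[OF inj])
  then have "multiplicity (?p j) (prime_code r x)
      = multiplicity (?p j) (\<Prod>q\<in>?p ` {1..r}. q ^ x (inv_into UNIV ?p q))"
    by simp
  also have "\<dots> = x j"
    by (subst multiplicity_prod_prime_powers) (use assms inj prime_enumerate in auto)
  finally show ?thesis .
qed

lemma ranked_wqo_monoid_nat_power: "ranked_wqo_monoid (nat_power r) (prime_code r)"
proof (intro ranked_wqo_monoid.intro monoid_nat_power ranked_wqo_monoid_axioms.intro)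
  show "inj_on (prime_code r) (carrier (nat_power r))"
  proof (rule inj_onI)
    fix x y
    assume "x \<in> carrier (nat_power r)" "y \<in> carrier (nat_power r)"
      and "prime_code r x = prime_code r y"
    moreover from this have "x i = y i" if "i \<in> {1..r}" for i
      using multiplicity_prime_code[OF that, of x] multiplicity_prime_code[OF that, of y] by simp
    ultimately show "x = y"
      unfolding carrier_nat_power by (intro PiE_ext)
  qed
next
  fix h g k
  have mult: "prime_code r (x \<otimes>\<^bsub>nat_power r\<^esub> k) = prime_code r x * prime_code r k" for x
    by (simp add: prime_code_def power_add prod.distrib)
  have "0 < prime_code r k"
    using prime_enumerate by (auto simp: prime_code_def prime_gt_0_nat intro!: prod_pos)
  moreover assume "prime_code r h < prime_code r g"
  ultimately show "prime_code r (h \<otimes>\<^bsub>nat_power r\<^esub> k) < prime_code r (g \<otimes>\<^bsub>nat_power r\<^esub> k)"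
    by (simp only: mult mult_less_mono1)
next
  fix s :: "nat \<Rightarrow> nat \<Rightarrow> nat"
  assume s: "range s \<subseteq> carrier (nat_power r)"
  obtain \<phi> where \<phi>: "strict_mono \<phi>" "\<forall>i\<in>{1..r}. incseq (\<lambda>n. s (\<phi> n) i)"
    using Dickson_subseq[of "{1..r}" s] by auto
  have "\<exists>k\<in>carrier (nat_power r). s (\<phi> (Suc n)) = s (\<phi> n) \<otimes>\<^bsub>nat_power r\<^esub> k" for n
  proof
    \<comment> \<open>Truncated subtraction is exact here, since every coordinate is nondecreasing
      along \<open>\<phi>\<close>.\<close>
    let ?k = "\<lambda>i\<in>{1..r}. s (\<phi> (Suc n)) i - s (\<phi> n) i"
    show "?k \<in> carrier (nat_power r)" by simp
    have "s (\<phi> (Suc n)) \<in> {1..r} \<rightarrow>\<^sub>E UNIV"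
      using s by auto
    then show "s (\<phi> (Suc n)) = s (\<phi> n) \<otimes>\<^bsub>nat_power r\<^esub> ?k"
      using \<phi>(2) by (auto simp: fun_eq_iff incseq_Suc_iff PiE_iff extensional_def)
  qed
  then show "\<exists>\<phi>. strict_mono \<phi> \<and>
      (\<forall>i. \<exists>k\<in>carrier (nat_power r). s (\<phi> (Suc i)) = s (\<phi> i) \<otimes>\<^bsub>nat_power r\<^esub> k)"
    using \<phi>(1) by blast
qed

section \<open>Admissible subgroups and subshifts\<close>

lemma admissible_Artinian_imp_group: "admissible_Artinian A H \<Longrightarrow> group A"
  by (simp add: admissible_Artinian_def)

lemma admissible_Artinian_Int:
  "\<lbrakk>admissible_Artinian A H; 1 \<le> n; K \<in> H n; L \<in> H n\<rbrakk> \<Longrightarrow> K \<inter> L \<in> H n"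
  by (simp add: admissible_Artinian_def)

lemma admissible_Artinian_projection:
  assumes "admissible_Artinian A H" "1 \<le> n" "\<sigma> \<in> {1..n} \<rightarrow> {1..m}" "inj_on \<sigma> {1..n}"
  shows "K \<in> H m \<Longrightarrow> (\<lambda>x. compose {1..n} x \<sigma>) ` K \<in> H n"
    and "K \<in> H n \<Longrightarrow> {x \<in> carrier (group_power A {1..m}). compose {1..n} x \<sigma> \<in> K} \<in> H m"
proof -
  have "n \<le> m"
    using card_inj_on_le[OF assms(4), of "{1..m}"] assms(3) by auto
  moreover have "\<forall>m n \<sigma>. 1 \<le> n \<longrightarrow> n \<le> m \<longrightarrow> \<sigma> \<in> {1..n} \<rightarrow> {1..m} \<longrightarrow> inj_on \<sigma> {1..n} \<longrightarrow>
       (\<forall>K\<in>H m. (\<lambda>x. compose {1..n} x \<sigma>) ` K \<in> H n) \<and>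
       (\<forall>K\<in>H n. {x \<in> carrier (group_power A {1..m}). compose {1..n} x \<sigma> \<in> K} \<in> H m)"
    using assms(1) unfolding admissible_Artinian_def by (elim conjE)
  ultimately show "K \<in> H m \<Longrightarrow> (\<lambda>x. compose {1..n} x \<sigma>) ` K \<in> H n"
    and "K \<in> H n \<Longrightarrow> {x \<in> carrier (group_power A {1..m}). compose {1..n} x \<sigma> \<in> K} \<in> H m"
    using assms(2-4) by simp_all
qed

lemma admissible_Artinian_dcc:
  fixes K :: "nat \<Rightarrow> (nat \<Rightarrow> 'a) set"
  assumes "admissible_Artinian A H" "1 \<le> n" "\<And>i. K i \<in> H n" "\<And>i. K (Suc i) \<subseteq> K i"
  shows "\<exists>N. \<forall>i\<ge>N. K i = K N"
  using assms unfolding admissible_Artinian_def by blast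

text \<open>Each condition \<open>x j = \<one>\<close> is the preimage of the trivial subgroup of
  \<open>A^1\<close> under the projection to coordinate \<open>j\<close>; finitely many such
  conditions are imposed by intersection.\<close>

lemma admissible_Artinian_trivial_coordinates:
  assumes A: "admissible_Artinian A H" and n: "1 \<le> n" and K: "K \<in> H n" and J: "J \<subseteq> {1..n}"
  shows "{x \<in> K. \<forall>j\<in>J. x j = \<one>\<^bsub>A\<^esub>} \<in> H n"
proof -
  have "finite J"
    using J finite_subset by blast
  then show ?thesis
    using J
  proof (induction J rule: finite_induct)
    case empty
    then show ?case using K by simp
  next
    case (insert j J)
    have "{\<one>\<^bsub>group_power A {1..1}\<^esub>} \<in> H 1"
      using A by (simp add: admissible_Artinian_def)
    moreover have "(\<lambda>_. j) \<in> {1..1::nat} \<rightarrow> {1..n}"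
      using insert.prems by auto
    ultimately have "{x \<in> carrier (group_power A {1..n}).
        compose {1..1::nat} x (\<lambda>_. j) \<in> {\<one>\<^bsub>group_power A {1..1}\<^esub>}} \<in> H n" (is "?P \<in> H n")
      by (intro admissible_Artinian_projection(2)[OF A]) simp_all
    then have "{x \<in> K. \<forall>j\<in>J. x j = \<one>\<^bsub>A\<^esub>} \<inter> ?P \<in> H n"
      using insert by (intro admissible_Artinian_Int[OF A n]) auto
    moreover have "K \<subseteq> carrier (group_power A {1..n})"
      using A n K unfolding admissible_Artinian_def by (meson subgroup.subset)
    then have "{x \<in> K. \<forall>j\<in>J. x j = \<one>\<^bsub>A\<^esub>} \<inter> ?P = {x \<in> K. \<forall>j\<in>insert j J. x j = \<one>\<^bsub>A\<^esub>}"
      by (auto simp: compose_def fun_eq_iff)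
    ultimately show ?case by simp
  qed
qed

text \<open>After an enumeration \<open>f\<close> of \<open>E\<close>, the set \<open>Z\<close>
  becomes a set \<open>J\<close> of coordinates and \<open>\<psi>\<close> becomes an injection
  \<open>\<sigma>\<close> of index ranges. Trivial coordinates are imposed first, and the result is
  then projected.\<close>

lemma admissible_subgroup_trivial_projection:
  fixes A :: "'a monoid" and E :: "'i set"
  assumes A: "admissible_Artinian A H" and adm: "admissible_subgroup A H E K"
    and n: "1 \<le> n" and \<psi>: "\<psi> \<in> {1..n} \<rightarrow> E" "inj_on \<psi> {1..n}" and Z: "Z \<subseteq> E"
  shows "(\<lambda>x. compose {1..n} x \<psi>) ` {x \<in> K. \<forall>e\<in>Z. x e = \<one>\<^bsub>A\<^esub>} \<in> H n"
proof -
  have "E \<noteq> {}"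
    using n \<psi>(1) by fastforce
  then obtain f where f: "bij_betw f {1..card E} E"
    and Q: "(\<lambda>x. compose {1..card E} x f) ` K \<in> H (card E)" (is "?Q \<in> _")
    using adm unfolding admissible_subgroup_def by blast
  define J where "J = {j \<in> {1..card E}. f j \<in> Z}"
  define \<sigma> where "\<sigma> i = inv_into {1..card E} f (\<psi> i)" for i
  have f\<sigma>: "f (\<sigma> i) = \<psi> i" and \<sigma>: "\<sigma> i \<in> {1..card E}" if "i \<in> {1..n}" for i
  proof -
    have "\<psi> i \<in> f ` {1..card E}"
      using that \<psi>(1) f by (auto simp: bij_betw_def)
    then show "f (\<sigma> i) = \<psi> i" "\<sigma> i \<in> {1..card E}"
      unfolding \<sigma>_def by (rule f_inv_into_f, rule inv_into_into)
  qed
  have inj: "inj_on \<sigma> {1..n}"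
    by (rule inj_onI) (metis f\<sigma> inj_onD[OF \<psi>(2)])
  have "1 \<le> card E"
    using \<sigma>[of 1] n by auto
  then have "{x \<in> ?Q. \<forall>j\<in>J. x j = \<one>\<^bsub>A\<^esub>} \<in> H (card E)"
    using A Q by (intro admissible_Artinian_trivial_coordinates) (auto simp: J_def)
  then have "(\<lambda>x. compose {1..n} x \<sigma>) ` {x \<in> ?Q. \<forall>j\<in>J. x j = \<one>\<^bsub>A\<^esub>} \<in> H n"
    using \<sigma> by (intro admissible_Artinian_projection(1)[OF A n _ inj]) auto
  moreover have "{x \<in> ?Q. \<forall>j\<in>J. x j = \<one>\<^bsub>A\<^esub>}
      = (\<lambda>x. compose {1..card E} x f) ` {x \<in> K. \<forall>e\<in>Z. x e = \<one>\<^bsub>A\<^esub>}"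
  proof -
    have "(\<forall>j\<in>J. compose {1..card E} x f j = \<one>\<^bsub>A\<^esub>) \<longleftrightarrow> (\<forall>j\<in>J. x (f j) = \<one>\<^bsub>A\<^esub>)" for x
      by (intro ball_cong) (simp_all add: J_def compose_eq)
    moreover have "Z \<subseteq> f ` {1..card E}"
      by (simp only: Z bij_betw_imp_surj_on[OF f])
    then have "Z = f ` J"
      unfolding J_def by auto
    ultimately have "(\<forall>j\<in>J. compose {1..card E} x f j = \<one>\<^bsub>A\<^esub>) \<longleftrightarrow> (\<forall>e\<in>Z. x e = \<one>\<^bsub>A\<^esub>)" for x
      by simp
    then show ?thesis by blast
  qed
  moreover have "compose {1..n} (compose {1..card E} x f) \<sigma> = compose {1..n} x \<psi>"
    for x :: "'i \<Rightarrow> 'a"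
    using f\<sigma> \<sigma> by (auto simp: compose_def fun_eq_iff)
  ultimately show ?thesis
    by (simp only: image_image)
qed

section \<open>Group operations on finite windows, and limits\<close>

context
  fixes G :: "'g monoid" and A :: "'a monoid" and H \<Sigma>
  assumes A: "group A" and \<Sigma>: "admissible_group_subshift G A H \<Sigma>"
begin

lemma admissible_group_subshift_subgroup:
  assumes "finite E" "E \<subseteq> carrier G"
  shows "subgroup ((\<lambda>x. restrict x E) ` \<Sigma>) (group_power A E)"
  using \<Sigma> assms by (simp add: admissible_group_subshift_def admissible_subgroup_def)

lemma admissible_group_subshift_subset: "\<Sigma> \<subseteq> carrier G \<rightarrow>\<^sub>E carrier A"
  using \<Sigma> by (simp add: admissible_group_subshift_def subshift_def)

lemma admissible_group_subshift_closed:
  "x \<in> \<Sigma> \<Longrightarrow> e \<in> carrier G \<Longrightarrow> x e \<in> carrier A"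
  using admissible_group_subshift_subset by auto

lemma admissible_group_subshift_nonempty: "\<Sigma> \<noteq> {}"
  \<comment> \<open>The empty window suffices: a subgroup of the trivial group is nonempty.\<close>
  using subgroup.one_closed[OF admissible_group_subshift_subgroup[of "{}"]] by auto

lemma admissible_group_subshift_shift:
  "x \<in> \<Sigma> \<Longrightarrow> g \<in> carrier G \<Longrightarrow> shift G g x \<in> \<Sigma>"
  using \<Sigma> by (simp add: admissible_group_subshift_def subshift_def)

text \<open>Admissibility yields subgroups on finite windows only, so \<open>u\<close> is controlled
  on \<open>E\<close> alone. This is enough for corrections made on one finite window at a
  time.\<close>

lemma admissible_group_subshift_mult:
  assumes "finite E" "E \<subseteq> carrier G" "x \<in> \<Sigma>" "y \<in> \<Sigma>"
  obtains u where "u \<in> \<Sigma>" "\<And>e. e \<in> E \<Longrightarrow> u e = x e \<otimes>\<^bsub>A\<^esub> y e"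
proof -
  have "restrict x E \<otimes>\<^bsub>group_power A E\<^esub> restrict y E \<in> (\<lambda>x. restrict x E) ` \<Sigma>"
    using assms by (intro subgroup.m_closed[OF admissible_group_subshift_subgroup]) auto
  then obtain u where u: "u \<in> \<Sigma>"
    "restrict x E \<otimes>\<^bsub>group_power A E\<^esub> restrict y E = restrict u E"
    by (rule imageE)
  have "u e = x e \<otimes>\<^bsub>A\<^esub> y e" if "e \<in> E" for e
    using fun_cong[OF u(2), of e] that by simp
  then show ?thesis
    using that u(1) by blast
qed

lemma admissible_group_subshift_inv:
  assumes "finite E" "E \<subseteq> carrier G" "x \<in> \<Sigma>"
  obtains u where "u \<in> \<Sigma>" "\<And>e. e \<in> E \<Longrightarrow> u e = inv\<^bsub>A\<^esub> (x e)"
proof -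
  have "inv\<^bsub>group_power A E\<^esub> (restrict x E) \<in> (\<lambda>x. restrict x E) ` \<Sigma>"
    using assms by (intro subgroup.m_inv_closed[OF admissible_group_subshift_subgroup]) auto
  then obtain u where u: "u \<in> \<Sigma>" "inv\<^bsub>group_power A E\<^esub> (restrict x E) = restrict u E"
    by (rule imageE)
  have "restrict x E \<in> E \<rightarrow>\<^sub>E carrier A"
    using assms admissible_group_subshift_closed by auto
  then have "u e = inv\<^bsub>A\<^esub> (x e)" if "e \<in> E" for e
    using fun_cong[OF u(2), of e] A that by simp
  then show ?thesis
    using that u(1) by blast
qed

text \<open>A basic neighbourhood of \<open>x\<close> in the prodiscrete topology constrains only
  finitely many coordinates, so it meets \<open>\<Sigma>\<close>, and \<open>\<Sigma>\<close> is
  closed.\<close>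

lemma admissible_group_subshift_limit:
  assumes x: "x \<in> carrier G \<rightarrow>\<^sub>E carrier A"
    and loc: "\<And>E. finite E \<Longrightarrow> E \<subseteq> carrier G \<Longrightarrow> \<exists>y\<in>\<Sigma>. \<forall>e\<in>E. y e = x e"
  shows "x \<in> \<Sigma>"
proof (rule ccontr)
  assume "x \<notin> \<Sigma>"
  have "openin (prodiscrete_topology (carrier G) (carrier A)) ((carrier G \<rightarrow>\<^sub>E carrier A) - \<Sigma>)"
    using \<Sigma> by (auto simp: admissible_group_subshift_def closedin_def prodiscrete_topology_def)
  then obtain U where U: "finite {i \<in> carrier G. U i \<noteq> carrier A}" "x \<in> Pi\<^sub>E (carrier G) U"
    "Pi\<^sub>E (carrier G) U \<subseteq> (carrier G \<rightarrow>\<^sub>E carrier A) - \<Sigma>"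
    using x \<open>x \<notin> \<Sigma>\<close> unfolding prodiscrete_topology_def openin_product_topology_alt
    by (auto dest!: bspec[of _ _ x])
  obtain y where y: "y \<in> \<Sigma>" "\<And>i. i \<in> carrier G \<Longrightarrow> U i \<noteq> carrier A \<Longrightarrow> y i = x i"
    using loc[OF U(1)] by auto
  have "y \<in> carrier G \<rightarrow>\<^sub>E carrier A"
    using admissible_group_subshift_subset y(1) by blast
  moreover have "y i \<in> U i" if "i \<in> carrier G" for i
  proof (cases "U i = carrier A")
    case True
    then show ?thesis using admissible_group_subshift_closed[OF y(1)] that by simp
  next
    case False
    then show ?thesis using y(2) U(2) that by (auto simp: PiE_iff)
  qed
  ultimately have "y \<in> Pi\<^sub>E (carrier G) U"
    by (simp add: PiE_iff)
  then show False using U(3) y(1) by blast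
qed

end

section \<open>The Markov property\<close>

context ranked_wqo_monoid
begin

section \<open>Leading patterns, the analogue of leading coefficients\<close>

text \<open>The fibre over \<open>g\<close> is transported to \<open>{1..order F}\<close> by
  \<open>\<phi>\<close>, so that the sets for different \<open>g\<close> lie in the same power of
  \<open>A\<close> and can be compared.\<close>

definition leading_patterns ::
    "'f monoid \<Rightarrow> 'a monoid \<Rightarrow> (nat \<Rightarrow> 'f) \<Rightarrow> ('m \<times> 'f \<Rightarrow> 'a) set \<Rightarrow> 'm \<Rightarrow> (nat \<Rightarrow> 'a) set"
  where "leading_patterns F A \<phi> \<Sigma> g = (\<lambda>x. compose {1..order F} x (\<lambda>i. (g, \<phi> i))) `
    {x \<in> \<Sigma>. \<forall>h\<in>carrier M. \<rho> h < \<rho> g \<longrightarrow> (\<forall>f\<in>carrier F. x (h, f) = \<one>\<^bsub>A\<^esub>)}"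

lemma leading_patternsI:
  assumes "x \<in> \<Sigma>"
    and "\<And>h f. \<lbrakk>h \<in> carrier M; \<rho> h < \<rho> g; f \<in> carrier F\<rbrakk> \<Longrightarrow> x (h, f) = \<one>\<^bsub>A\<^esub>"
  shows "compose {1..order F} x (\<lambda>i. (g, \<phi> i)) \<in> leading_patterns F A \<phi> \<Sigma> g"
  unfolding leading_patterns_def using assms by (intro imageI) simp

lemma leading_patternsE:
  assumes "p \<in> leading_patterns F A \<phi> \<Sigma> g"
  obtains x where "x \<in> \<Sigma>" "p = compose {1..order F} x (\<lambda>i. (g, \<phi> i))"
    "\<And>h f. \<lbrakk>h \<in> carrier M; \<rho> h < \<rho> g; f \<in> carrier F\<rbrakk> \<Longrightarrow> x (h, f) = \<one>\<^bsub>A\<^esub>"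
  using assms unfolding leading_patterns_def by auto

text \<open>Only positions of rank at most \<open>\<rho> g\<close> matter, and these form a finite
  window \<open>E\<close>; the conditions of triviality concern the part \<open>Z\<close> of
  strictly smaller rank.\<close>

lemma leading_patterns_admissible:
  fixes F :: "'f monoid" and A :: "'a monoid"
  assumes A: "admissible_Artinian A H" and \<Sigma>: "admissible_group_subshift (M \<times>\<times> F) A H \<Sigma>"
    and F: "monoid F" "finite (carrier F)" and \<phi>: "bij_betw \<phi> {1..order F} (carrier F)"
    and g: "g \<in> carrier M"
  shows "leading_patterns F A \<phi> \<Sigma> g \<in> H (order F)"
proof -
  define E where "E = {h \<in> carrier M. \<rho> h \<le> \<rho> g} \<times> carrier F"
  define Z where "Z = {h \<in> carrier M. \<rho> h < \<rho> g} \<times> carrier F"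
  have "finite E"
    using finite_rank_le F(2) by (simp add: E_def)
  then have "admissible_subgroup A H E ((\<lambda>x. restrict x E) ` \<Sigma>)"
    using \<Sigma> by (auto simp: admissible_group_subshift_def E_def)
  moreover have "1 \<le> order F"
    using F monoid.one_closed[OF F(1)] by (auto simp: order_def Suc_le_eq card_gt_0_iff)
  moreover have gE: "(\<lambda>i. (g, \<phi> i)) \<in> {1..order F} \<rightarrow> E"
    using bij_betwE[OF \<phi>] g by (simp add: E_def)
  moreover have "inj_on (\<lambda>i. (g, \<phi> i)) {1..order F}"
    by (auto intro!: inj_onI dest: inj_onD[OF bij_betw_imp_inj_on[OF \<phi>]])
  moreover have ZE: "Z \<subseteq> E"
    by (auto simp: Z_def E_def)
  ultimately have "(\<lambda>x. compose {1..order F} x (\<lambda>i. (g, \<phi> i))) `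
      {x \<in> (\<lambda>x. restrict x E) ` \<Sigma>. \<forall>e\<in>Z. x e = \<one>\<^bsub>A\<^esub>} \<in> H (order F)"
    by (rule admissible_subgroup_trivial_projection[OF A])
  moreover have "{x \<in> (\<lambda>x. restrict x E) ` \<Sigma>. \<forall>e\<in>Z. x e = \<one>\<^bsub>A\<^esub>}
      = (\<lambda>x. restrict x E) ` {x \<in> \<Sigma>. \<forall>e\<in>Z. x e = \<one>\<^bsub>A\<^esub>}"
  proof -
    have "(\<forall>e\<in>Z. restrict x E e = \<one>\<^bsub>A\<^esub>) \<longleftrightarrow> (\<forall>e\<in>Z. x e = \<one>\<^bsub>A\<^esub>)" for x
      using ZE by (intro ball_cong) auto
    then show ?thesis by blast
  qed
  moreover have "compose {1..order F} (restrict x E) (\<lambda>i. (g, \<phi> i))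
      = compose {1..order F} x (\<lambda>i. (g, \<phi> i))" for x :: "'m \<times> 'f \<Rightarrow> 'a"
    using gE by (auto simp: compose_def fun_eq_iff)
  moreover have "(\<forall>e\<in>Z. x e = \<one>\<^bsub>A\<^esub>) \<longleftrightarrow>
      (\<forall>h\<in>carrier M. \<rho> h < \<rho> g \<longrightarrow> (\<forall>f\<in>carrier F. x (h, f) = \<one>\<^bsub>A\<^esub>))" for x
    by (auto simp: Z_def)
  ultimately show ?thesis
    by (simp only: leading_patterns_def image_image)
qed

text \<open>The shift by \<open>(k, \<one>)\<close> carries the pattern over
  \<open>m \<otimes> k\<close> to the fibre over \<open>m\<close>. By \<open>rank_mult\<close>,
  positions below \<open>m\<close> read off values below \<open>m \<otimes> k\<close>, which are
  trivial.\<close>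

lemma leading_patterns_mult_subset:
  assumes A: "group A" and \<Sigma>: "admissible_group_subshift (M \<times>\<times> F) A H \<Sigma>"
    and F: "monoid F" and \<phi>: "bij_betw \<phi> {1..order F} (carrier F)"
    and m: "m \<in> carrier M" and k: "k \<in> carrier M"
  shows "leading_patterns F A \<phi> \<Sigma> (m \<otimes> k) \<subseteq> leading_patterns F A \<phi> \<Sigma> m"
proof
  fix p assume "p \<in> leading_patterns F A \<phi> \<Sigma> (m \<otimes> k)"
  then obtain x where x: "x \<in> \<Sigma>" and p: "p = compose {1..order F} x (\<lambda>i. (m \<otimes> k, \<phi> i))"
    and triv: "\<And>h f. \<lbrakk>h \<in> carrier M; \<rho> h < \<rho> (m \<otimes> k); f \<in> carrier F\<rbrakk> \<Longrightarrow> x (h, f) = \<one>\<^bsub>A\<^esub>"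
    by (rule leading_patternsE) blast
  interpret F: monoid F by fact
  let ?y = "shift (M \<times>\<times> F) (k, \<one>\<^bsub>F\<^esub>) x"
  have y: "?y (h, f) = x (h \<otimes> k, f)" if "h \<in> carrier M" "f \<in> carrier F" for h f
    using that by (simp add: shift_def)
  have "p = compose {1..order F} ?y (\<lambda>i. (m, \<phi> i))"
    using y m bij_betwE[OF \<phi>] by (simp add: p compose_def fun_eq_iff)
  moreover have "compose {1..order F} ?y (\<lambda>i. (m, \<phi> i)) \<in> leading_patterns F A \<phi> \<Sigma> m"
  proof (rule leading_patternsI)
    show "?y \<in> \<Sigma>"
      using admissible_group_subshift_shift[OF A \<Sigma> x] k by simp
    show "?y (h, f) = \<one>\<^bsub>A\<^esub>" if "h \<in> carrier M" "\<rho> h < \<rho> m" "f \<in> carrier F" for h f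
      using that y triv rank_mult m k by simp
  qed
  ultimately show "p \<in> leading_patterns F A \<phi> \<Sigma> m"
    by (simp only:)
qed

lemma admissible_group_subshift_finite_type:
  fixes F :: "'f monoid" and A :: "'a monoid"
  assumes Art: "admissible_Artinian A H" and \<Sigma>: "admissible_group_subshift (M \<times>\<times> F) A H \<Sigma>"
    and F: "monoid F" "finite (carrier F)"
  shows "finite_type (M \<times>\<times> F) (carrier A) \<Sigma>"
proof -
  interpret F: monoid F by fact
  have A: "group A"
    using Art by (rule admissible_Artinian_imp_group)
  interpret A: group A by fact
  note closed = admissible_group_subshift_closed[OF A \<Sigma>]
  have n: "1 \<le> order F"
    using F F.one_closed by (auto simp: order_def Suc_le_eq card_gt_0_iff)
  obtain \<phi> where \<phi>: "bij_betw \<phi> {1..order F} (carrier F)"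
    using ex_bij_betw_nat_finite_1[OF F(2)] by (auto simp: order_def)
  define L where "L = leading_patterns F A \<phi> \<Sigma>"
  have anti: "L (m \<otimes> k) \<subseteq> L m" if "m \<in> carrier M" "k \<in> carrier M" for m k
    using that unfolding L_def by (rule leading_patterns_mult_subset[OF A \<Sigma> F(1) \<phi>])
  have dcc: "\<exists>i. L (s (Suc i)) = L (s i)"
    if s: "range s \<subseteq> carrier M" "\<And>i. L (s (Suc i)) \<subseteq> L (s i)" for s
  proof -
    have "L (s i) \<in> H (order F)" for i
      using s(1) unfolding L_def by (intro leading_patterns_admissible[OF Art \<Sigma> F \<phi>]) auto
    with s(2) have "\<exists>N. \<forall>i\<ge>N. L (s i) = L (s N)"
      by (intro admissible_Artinian_dcc[OF Art n])
    then obtain N where "\<forall>i\<ge>N. L (s i) = L (s N)"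
      by blast
    then show ?thesis by (meson le_SucI order_refl)
  qed
  obtain S where "finite S \<and> S \<subseteq> carrier M \<and>
      (\<forall>g\<in>carrier M. \<exists>m\<in>S. \<exists>k\<in>carrier M. g = m \<otimes> k \<and> L m = L g)"
    using finite_basis[of L, OF anti dcc] ..
  then have S: "finite S" "S \<subseteq> carrier M"
    and basis: "\<forall>g\<in>carrier M. \<exists>m\<in>S. \<exists>k\<in>carrier M. g = m \<otimes> k \<and> L m = L g"
    by simp_all
  \<comment> \<open>The bound \<open>R\<close> makes the window \<open>D\<close> contain, for each
    \<open>m\<close> in \<open>S\<close>, the fibre over \<open>m\<close> and all positions of
    smaller rank.\<close>
  define R where "R = Max (\<rho> ` S)"
  define D where "D = {h \<in> carrier M. \<rho> h \<le> R} \<times> carrier F"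
  have D: "finite D" "D \<subseteq> carrier (M \<times>\<times> F)"
    using finite_rank_le F(2) by (auto simp: D_def)
  define P where "P = (\<lambda>x. restrict x D) ` \<Sigma>"
  have "\<Sigma> \<subseteq> subshift_by_patterns (M \<times>\<times> F) (carrier A) D P"
  proof
    fix x assume x: "x \<in> \<Sigma>"
    then show "x \<in> subshift_by_patterns (M \<times>\<times> F) (carrier A) D P"
      unfolding subshift_by_patterns_def P_def
      using admissible_group_subshift_subset[OF A \<Sigma>] admissible_group_subshift_shift[OF A \<Sigma> x]
      by (intro CollectI conjI ballI imageI) (rule subsetD)
  qed
  moreover have "x \<in> \<Sigma>" if x: "x \<in> subshift_by_patterns (M \<times>\<times> F) (carrier A) D P" for x
  proof (rule admissible_group_subshift_limit[OF A \<Sigma>])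
    show xA: "x \<in> carrier (M \<times>\<times> F) \<rightarrow>\<^sub>E carrier A"
      using x by (simp add: subshift_by_patterns_def)
    \<comment> \<open>Induction on a rank bound. Since the rank is injective, each step adds at most
      one fibre, the one over the element \<open>g\<close> of rank \<open>N\<close>.\<close>
    have agree: "\<exists>y\<in>\<Sigma>. \<forall>h\<in>carrier M. \<rho> h < N \<longrightarrow> (\<forall>f\<in>carrier F. y (h, f) = x (h, f))" for N
    proof (induction N)
      case 0
      then show ?case using admissible_group_subshift_nonempty[OF A \<Sigma>] by auto
    next
      case (Suc N)
      then obtain y where y: "y \<in> \<Sigma>"
        and yx: "\<And>h f. \<lbrakk>h \<in> carrier M; \<rho> h < N; f \<in> carrier F\<rbrakk> \<Longrightarrow> y (h, f) = x (h, f)"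
        by blast
      show ?case
      proof (cases "\<exists>g\<in>carrier M. \<rho> g = N")
        case False
        then show ?thesis using y yx by (metis less_Suc_eq)
      next
        case True
        then obtain g where g: "g \<in> carrier M" "\<rho> g = N" by blast
        obtain m k where m: "m \<in> S" and k: "k \<in> carrier M" and gmk: "g = m \<otimes> k"
          and Lm: "L m = L g"
          using bspec[OF basis g(1)] by blast
        have mM: "m \<in> carrier M" using m S(2) by blast
        have mR: "\<rho> m \<le> R" using m S(1) by (simp add: R_def)
        let ?t = "(k, \<one>\<^bsub>F\<^esub>)"
        have t: "?t \<in> carrier (M \<times>\<times> F)" using k by simp
        have sh: "shift (M \<times>\<times> F) ?t z (h, f) = z (h \<otimes> k, f)"
          if "h \<in> carrier M" "f \<in> carrier F" for z :: "'m \<times> 'f \<Rightarrow> 'a" and h f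
          using that by (simp add: shift_def)
        \<comment> \<open>The pattern condition at \<open>(k, \<one>)\<close> supplies an element of
          \<open>\<Sigma>\<close> that looks on \<open>D\<close> like the shifted
          \<open>x\<close>.\<close>
        have "restrict (shift (M \<times>\<times> F) ?t x) D \<in> P"
          using x t unfolding subshift_by_patterns_def by blast
        then obtain x' where x': "x' \<in> \<Sigma>"
          and "restrict (shift (M \<times>\<times> F) ?t x) D = restrict x' D"
          by (auto simp: P_def)
        then have x'x: "x' e = shift (M \<times>\<times> F) ?t x e" if "e \<in> D" for e
          using that by (metis restrict_apply')
        have "shift (M \<times>\<times> F) ?t y \<in> \<Sigma>"
          by (rule admissible_group_subshift_shift[OF A \<Sigma> y t])
        then obtain y' where y': "y' \<in> \<Sigma>"
          and y'y: "\<And>e. e \<in> D \<Longrightarrow> y' e = inv\<^bsub>A\<^esub> (shift (M \<times>\<times> F) ?t y e)"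
          using admissible_group_subshift_inv[OF A \<Sigma> D] by blast
        \<comment> \<open>On \<open>D\<close>, \<open>w\<close> is the discrepancy between the
          shifts of \<open>y\<close> and \<open>x\<close>. The inverse stands on the left because
          \<open>y\<close> will be corrected by multiplication on the right.\<close>
        obtain w where w: "w \<in> \<Sigma>" and wD: "\<And>e. e \<in> D \<Longrightarrow> w e = y' e \<otimes>\<^bsub>A\<^esub> x' e"
          using admissible_group_subshift_mult[OF A \<Sigma> D y' x'] by blast
        have w_eq: "w (h, f) = inv\<^bsub>A\<^esub> (y (h \<otimes> k, f)) \<otimes>\<^bsub>A\<^esub> x (h \<otimes> k, f)"
          if "h \<in> carrier M" "\<rho> h \<le> R" "f \<in> carrier F" for h f
          using that wD[of "(h, f)"] y'y[of "(h, f)"] x'x[of "(h, f)"] sh by (simp add: D_def)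
        have "w (h, f) = \<one>\<^bsub>A\<^esub>" if "h \<in> carrier M" "\<rho> h < \<rho> m" "f \<in> carrier F" for h f
        proof -
          \<comment> \<open>Such a position is translated by \<open>k\<close> to rank below
            \<open>N\<close>, where \<open>y\<close> and \<open>x\<close> already agree.\<close>
          have "\<rho> (h \<otimes> k) < N"
            using rank_mult[OF that(1) mM k that(2)] g gmk by simp
          then show ?thesis
            using w_eq[of h f] that mR yx[of "h \<otimes> k" f] k closed[OF y, of "(h \<otimes> k, f)"] by auto
        qed
        then have "compose {1..order F} w (\<lambda>i. (m, \<phi> i)) \<in> L m"
          unfolding L_def by (intro leading_patternsI w)
        then have "compose {1..order F} w (\<lambda>i. (m, \<phi> i)) \<in> L g"
          by (simp only: Lm)
        \<comment> \<open>Here \<open>L m = L g\<close> undoes the shift, which need not be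
          invertible: the discrepancy seen at \<open>m\<close> is realised at \<open>g\<close> by an
          element of \<open>\<Sigma>\<close> that is trivial at all ranks below
          \<open>N\<close>.\<close>
        then obtain v where v: "v \<in> \<Sigma>"
          and vw: "compose {1..order F} w (\<lambda>i. (m, \<phi> i)) = compose {1..order F} v (\<lambda>i. (g, \<phi> i))"
          and v1: "\<And>h f. \<lbrakk>h \<in> carrier M; \<rho> h < N; f \<in> carrier F\<rbrakk> \<Longrightarrow> v (h, f) = \<one>\<^bsub>A\<^esub>"
          unfolding L_def g(2)[symmetric] by (rule leading_patternsE) blast
        have v2: "v (g, f) = w (m, f)" if f: "f \<in> carrier F" for f
        proof -
          obtain i where "i \<in> {1..order F}" "f = \<phi> i"
            using f bij_betw_imp_surj_on[OF \<phi>] by blast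
          then show ?thesis
            using fun_cong[OF vw, of i] by (simp add: compose_eq)
        qed
        define B where "B = {h \<in> carrier M. \<rho> h \<le> N} \<times> carrier F"
        have B: "finite B" "B \<subseteq> carrier (M \<times>\<times> F)"
          using finite_rank_le F(2) by (auto simp: B_def)
        \<comment> \<open>The product keeps the values of \<open>y\<close> below rank
          \<open>N\<close>, and over \<open>g\<close> it gives \<open>y\<close> times its inverse
          times \<open>x\<close>.\<close>
        obtain u where u: "u \<in> \<Sigma>" and uB: "\<And>e. e \<in> B \<Longrightarrow> u e = y e \<otimes>\<^bsub>A\<^esub> v e"
          using admissible_group_subshift_mult[OF A \<Sigma> B y v] by blast
        have "u (h, f) = x (h, f)" if h: "h \<in> carrier M" "\<rho> h < Suc N" and f: "f \<in> carrier F" for h f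
        proof (cases "\<rho> h < N")
          case True
          then show ?thesis
            using uB[of "(h, f)"] h f v1[of h f] yx[of h f] closed[OF y, of "(h, f)"]
            by (simp add: B_def)
        next
          case False
          then have hg: "h = g"
            using h g inj_onD[OF inj_rank] by auto
          have "x (g, f) \<in> carrier A" "y (g, f) \<in> carrier A"
            using xA closed[OF y] g f by auto
          then show ?thesis
            using uB[of "(h, f)"] h f v2[of f] w_eq[OF mM mR f]
            by (simp add: hg gmk B_def g(2)[unfolded gmk] flip: A.m_assoc)
        qed
        then show ?thesis using u by blast
      qed
    qed
    fix E :: "('m \<times> 'f) set" assume E: "finite E" "E \<subseteq> carrier (M \<times>\<times> F)"
    \<comment> \<open>The rank bound exceeds the rank of every position in \<open>E\<close>. For
      empty \<open>E\<close> the value of \<open>Max\<close> is unspecified, but there is nothing to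
      match.\<close>
    obtain y where y: "y \<in> \<Sigma>" "\<forall>h\<in>carrier M. \<rho> h < Suc (Max (\<rho> ` fst ` E)) \<longrightarrow>
        (\<forall>f\<in>carrier F. y (h, f) = x (h, f))"
      using agree by blast
    have "y e = x e" if e: "e \<in> E" for e
    proof -
      have "\<rho> (fst e) < Suc (Max (\<rho> ` fst ` E))"
        using E(1) e by (simp add: less_Suc_eq_le)
      then have "y (fst e, snd e) = x (fst e, snd e)"
        using y(2) E(2) e by (auto simp del: prod.collapse)
      then show ?thesis by simp
    qed
    then show "\<exists>y\<in>\<Sigma>. \<forall>e\<in>E. y e = x e"
      using y(1) by blast
  qed
  ultimately have "\<Sigma> = subshift_by_patterns (M \<times>\<times> F) (carrier A) D P"
    by blast
  moreover have "P \<subseteq> D \<rightarrow>\<^sub>E carrier A"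
    using D(2) closed by (auto simp: P_def)
  ultimately show ?thesis
    unfolding finite_type_def using D by blast
qed

end

theorem theorem6p3:
  fixes F :: "'f monoid" and r :: nat
  assumes "monoid F" and "finite (carrier F)"
  shows "admissible_Markov_type TYPE('a) (nat_power r \<times>\<times> F)"
proof -
  interpret ranked_wqo_monoid "nat_power r" "prime_code r"
    by (rule ranked_wqo_monoid_nat_power)
  have "monoid (nat_power r \<times>\<times> F)"
    by (rule DirProd_monoid[OF monoid_nat_power assms(1)])
  moreover have "countable (carrier (nat_power r \<times>\<times> F))"
    using countable_carrier assms(2) by (simp add: countable_finite del: carrier_nat_power)
  moreover have "finite_type (nat_power r \<times>\<times> F) (carrier A) \<Sigma>"
    if "admissible_Artinian A H" "admissible_group_subshift (nat_power r \<times>\<times> F) A H \<Sigma>"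
    for A :: "'a monoid" and H \<Sigma>
    using that assms by (rule admissible_group_subshift_finite_type)
  ultimately show ?thesis
    unfolding admissible_Markov_type_def by (intro conjI allI impI)
qed

end
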